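(* Let $k$ be a field, $G$ a group, $t\in G$ an element of infinite order, and let $\mathcal B$ be a $\Phi$-set theoretic basis of $k[G]$. Then no element of $\mathcal B$ can have support containing two distinct points of the same coset $\langle t\rangle g$: for every $b\in\mathcal B$ and every $g\in G$, $$\bigl|\mathrm{supp}(b)\cap\langle t\rangle g\bigr|\le 1.$$
   Context: For $x=\sum_{g\in G}x_g g\in k[G]$, $\mathrm{supp}(x)=\{g: x_g\neq0\}$. $\Phi_{k[G]}$ is the linear map on $k[G]\otimes k[G]$ with $g\otimes h\mapsto g\otimes gh$ for $g,h\in G$. A basis $\mathcal B$ of $k[G]$ is $\Phi$-set theoretic if for all $b,c\in\mathcal B$ there are $b',c'\in\mathcal B$ with $\Phi_{k[G]}(b\otimes c)=b'\otimes c'$. *)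

theory Defs
  imports "HOL-Library.Poly_Mapping" "HOL-Algebra.Multiplicative_Group"
begin

definition scale :: "'k \<Rightarrow> ('a \<Rightarrow>\<^sub>0 'k) \<Rightarrow> ('a \<Rightarrow>\<^sub>0 'k::field)"
  where "scale c x = Poly_Mapping.map ((*) c) x"

lemma lookup_scale [simp]: "Poly_Mapping.lookup (scale c x) a = c * Poly_Mapping.lookup x a"
  by (simp add: scale_def Poly_Mapping.map.rep_eq when_def)

interpretation pm: vector_space "scale :: 'k::field \<Rightarrow> ('a \<Rightarrow>\<^sub>0 'k) \<Rightarrow> _"
  by unfold_locales (auto intro!: poly_mapping_eqI simp: lookup_add algebra_simps)

text \<open>
  The group algebra \<open>k[G]\<close>, for \<open>k\<close> a type of class \<^class>\<open>field\<close>: the finitely supported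
  functions that vanish off the carrier. The type \<open>'g\<close> may be larger than the carrier,
  so \<open>k[G]\<close> is a subspace of the whole type. The support of \<open>x\<close> is \<^term>\<open>Poly_Mapping.keys x\<close>.
\<close>

definition group_algebra :: "('g, 'm) monoid_scheme \<Rightarrow> ('g \<Rightarrow>\<^sub>0 'k::field) set"
  where "group_algebra G = {x. Poly_Mapping.keys x \<subseteq> carrier G}"

definition basis_of_group_algebra ::
    "('g, 'm) monoid_scheme \<Rightarrow> ('g \<Rightarrow>\<^sub>0 'k::field) set \<Rightarrow> bool"
  where "basis_of_group_algebra G B \<longleftrightarrow> pm.independent B \<and> pm.span B = group_algebra G"

text \<open>
  The tensor product of the free spaces on \<open>'a\<close> and \<open>'b\<close> is modelled as the free space on
  \<open>'a \<times> 'b\<close>; the pure tensor \<open>x \<otimes> y\<close> has the coefficient \<open>x\<^sub>a y\<^sub>b\<close> at \<open>(a, b)\<close>.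
  The lemmas \<open>tensor_universal\<close> and \<open>span_tensor_group_algebra\<close> below justify this model.
\<close>

lift_definition tensor :: "('a \<Rightarrow>\<^sub>0 'k) \<Rightarrow> ('b \<Rightarrow>\<^sub>0 'k) \<Rightarrow> ('a \<times> 'b \<Rightarrow>\<^sub>0 'k::field)"
  is "\<lambda>x y (a, b). x a * y b"
proof -
  fix x :: "'a \<Rightarrow> 'k::field" and y :: "'b \<Rightarrow> 'k::field"
  assume "finite {a. x a \<noteq> 0}" "finite {b. y b \<noteq> 0}"
  then have "finite ({a. x a \<noteq> 0} \<times> {b. y b \<noteq> 0})"
    by (rule finite_cartesian_product)
  then show "finite {p. (case p of (a, b) \<Rightarrow> x a * y b) \<noteq> 0}"
    by (rule rev_finite_subset) auto
qed

text \<open>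
  The linear map with \<open>g \<otimes> h \<mapsto> g \<otimes> gh\<close> on group elements, extended linearly from the
  basis of pairs \<open>(g, h)\<close>; see \<open>linear_Phi\<close> and \<open>Phi_tensor_single\<close>.
\<close>

definition Phi :: "('g, 'm) monoid_scheme \<Rightarrow> ('g \<times> 'g \<Rightarrow>\<^sub>0 'k) \<Rightarrow> ('g \<times> 'g \<Rightarrow>\<^sub>0 'k::field)"
  where "Phi G z = (\<Sum>(g, h)\<in>Poly_Mapping.keys z.
           scale (Poly_Mapping.lookup z (g, h))
             (tensor (Poly_Mapping.single g 1) (Poly_Mapping.single (g \<otimes>\<^bsub>G\<^esub> h) 1)))"

definition Phi_set_theoretic :: "('g, 'm) monoid_scheme \<Rightarrow> ('g \<Rightarrow>\<^sub>0 'k::field) set \<Rightarrow> bool"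
  where "Phi_set_theoretic G B \<longleftrightarrow>
    (\<forall>b\<in>B. \<forall>c\<in>B. \<exists>b'\<in>B. \<exists>c'\<in>B. Phi G (tensor b c) = tensor b' c')"

lemma lookup_tensor [simp]: "Poly_Mapping.lookup (tensor x y) (a, b) = Poly_Mapping.lookup x a * Poly_Mapping.lookup y b"
  by (simp add: tensor.rep_eq)

lemma tensor_single_single:
  "tensor (Poly_Mapping.single a c) (Poly_Mapping.single b d) = Poly_Mapping.single (a, b) (c * d)"
  by (rule poly_mapping_eqI) (auto simp: tensor.rep_eq lookup_single when_def split: if_splits)

lemma linear_scale_tensor_right: "Vector_Spaces.linear scale scale (tensor x)"
  by (intro Vector_Spaces.linear.intro module_hom.intro module_hom_axioms.intro pm.vector_space_axioms pm.module_axioms)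
    (auto intro!: poly_mapping_eqI simp: lookup_add algebra_simps)

lemma linear_scale_tensor_left: "Vector_Spaces.linear scale scale (\<lambda>x. tensor x y)"
  by (intro Vector_Spaces.linear.intro module_hom.intro module_hom_axioms.intro pm.vector_space_axioms pm.module_axioms)
    (auto intro!: poly_mapping_eqI simp: lookup_add algebra_simps)

lemma sum_keys_single: "(\<Sum>a\<in>Poly_Mapping.keys z. scale (Poly_Mapping.lookup z a) (Poly_Mapping.single a 1)) = z"
proof (rule poly_mapping_eqI)
  fix b
  have "(\<Sum>a\<in>Poly_Mapping.keys z. Poly_Mapping.lookup z a * (if a = b then 1 else 0)) =
      (\<Sum>a\<in>Poly_Mapping.keys z. if a = b then Poly_Mapping.lookup z a else 0)"
    by (rule sum.cong) auto
  also have "\<dots> = Poly_Mapping.lookup z b"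
    by (simp add: in_keys_iff)
  finally show "Poly_Mapping.lookup (\<Sum>a\<in>Poly_Mapping.keys z. scale (Poly_Mapping.lookup z a) (Poly_Mapping.single a 1)) b =
      Poly_Mapping.lookup z b"
    by (simp add: lookup_sum lookup_single when_def)
qed

lemma linear_extension:
  fixes s :: "'k::field \<Rightarrow> 'w::ab_group_add \<Rightarrow> 'w" and u :: "'a \<Rightarrow> 'w"
  assumes "vector_space s"
  shows "Vector_Spaces.linear scale s (\<lambda>z. \<Sum>a\<in>Poly_Mapping.keys z. s (Poly_Mapping.lookup z a) (u a))"
proof -
  interpret W: vector_space s by (fact assms)
  have supp: "(\<Sum>a\<in>Poly_Mapping.keys z. s (Poly_Mapping.lookup z a) (u a)) = (\<Sum>a\<in>S. s (Poly_Mapping.lookup z a) (u a))"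
    if "finite S" "Poly_Mapping.keys z \<subseteq> S" for z :: "'a \<Rightarrow>\<^sub>0 'k" and S
    using that by (intro sum.mono_neutral_left) (auto simp: in_keys_iff)
  show ?thesis
  proof (intro Vector_Spaces.linear.intro module_hom.intro module_hom_axioms.intro
      pm.vector_space_axioms pm.module_axioms W.vector_space_axioms W.module_axioms)
    fix x y :: "'a \<Rightarrow>\<^sub>0 'k"
    let ?S = "Poly_Mapping.keys x \<union> Poly_Mapping.keys y"
    have "(\<Sum>a\<in>Poly_Mapping.keys (x + y). s (Poly_Mapping.lookup (x + y) a) (u a)) =
        (\<Sum>a\<in>?S. s (Poly_Mapping.lookup (x + y) a) (u a))"
      by (rule supp) (simp_all add: Poly_Mapping.keys_add)
    moreover have "(\<Sum>a\<in>Poly_Mapping.keys x. s (Poly_Mapping.lookup x a) (u a)) =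
        (\<Sum>a\<in>?S. s (Poly_Mapping.lookup x a) (u a))"
      by (rule supp) simp_all
    moreover have "(\<Sum>a\<in>Poly_Mapping.keys y. s (Poly_Mapping.lookup y a) (u a)) =
        (\<Sum>a\<in>?S. s (Poly_Mapping.lookup y a) (u a))"
      by (rule supp) simp_all
    moreover have "(\<Sum>a\<in>?S. s (Poly_Mapping.lookup (x + y) a) (u a)) =
        (\<Sum>a\<in>?S. s (Poly_Mapping.lookup x a) (u a)) + (\<Sum>a\<in>?S. s (Poly_Mapping.lookup y a) (u a))"
      by (simp only: lookup_add W.scale_left_distrib sum.distrib)
    ultimately show "(\<Sum>a\<in>Poly_Mapping.keys (x + y). s (Poly_Mapping.lookup (x + y) a) (u a)) =
        (\<Sum>a\<in>Poly_Mapping.keys x. s (Poly_Mapping.lookup x a) (u a)) + (\<Sum>a\<in>Poly_Mapping.keys y. s (Poly_Mapping.lookup y a) (u a))"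
      by (simp only:)
  next
    fix c and x :: "'a \<Rightarrow>\<^sub>0 'k"
    have "Poly_Mapping.keys (scale c x) \<subseteq> Poly_Mapping.keys x"
      by (auto simp: in_keys_iff)
    then have "(\<Sum>a\<in>Poly_Mapping.keys (scale c x). s (Poly_Mapping.lookup (scale c x) a) (u a)) =
        (\<Sum>a\<in>Poly_Mapping.keys x. s (Poly_Mapping.lookup (scale c x) a) (u a))"
      by (intro supp) simp_all
    also have "\<dots> = s c (\<Sum>a\<in>Poly_Mapping.keys x. s (Poly_Mapping.lookup x a) (u a))"
      by (simp add: W.scale_sum_right)
    finally show "(\<Sum>a\<in>Poly_Mapping.keys (scale c x). s (Poly_Mapping.lookup (scale c x) a) (u a)) =
        s c (\<Sum>a\<in>Poly_Mapping.keys x. s (Poly_Mapping.lookup x a) (u a))" .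
  qed
qed

lemma linear_eq_on_singles:
  fixes s :: "'k::field \<Rightarrow> 'w::ab_group_add \<Rightarrow> 'w"
  assumes f: "Vector_Spaces.linear scale s f" and g: "Vector_Spaces.linear scale s g"
    and eq: "\<And>a. f (Poly_Mapping.single a 1) = g (Poly_Mapping.single a 1)"
  shows "f = g"
proof
  interpret f: Vector_Spaces.linear scale s f by (fact f)
  interpret g: Vector_Spaces.linear scale s g by (fact g)
  fix z
  have "f z = f (\<Sum>a\<in>Poly_Mapping.keys z. scale (Poly_Mapping.lookup z a) (Poly_Mapping.single a 1))"
    by (simp only: sum_keys_single)
  also have "\<dots> = g (\<Sum>a\<in>Poly_Mapping.keys z. scale (Poly_Mapping.lookup z a) (Poly_Mapping.single a 1))"
    by (simp only: f.sum g.sum f.scale g.scale eq)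
  finally show "f z = g z"
    by (simp only: sum_keys_single)
qed

lemma tensor_universal:
  fixes s :: "'k::field \<Rightarrow> 'w::ab_group_add \<Rightarrow> 'w"
    and \<beta> :: "('a \<Rightarrow>\<^sub>0 'k) \<Rightarrow> ('b \<Rightarrow>\<^sub>0 'k) \<Rightarrow> 'w"
  assumes right: "\<And>x. Vector_Spaces.linear scale s (\<beta> x)"
    and left: "\<And>y. Vector_Spaces.linear scale s (\<lambda>x. \<beta> x y)"
  shows "\<exists>!f. Vector_Spaces.linear scale s f \<and> (\<forall>x y. f (tensor x y) = \<beta> x y)"
proof -
  interpret W: vector_space s
    using right[of 0] by (simp add: Vector_Spaces.linear_def)
  define f where "f = (\<lambda>z. \<Sum>p\<in>Poly_Mapping.keys z.
    s (Poly_Mapping.lookup z p) (\<beta> (Poly_Mapping.single (fst p) 1) (Poly_Mapping.single (snd p) 1)))"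
  have f: "Vector_Spaces.linear scale s f"
    unfolding f_def by (rule linear_extension) (rule W.vector_space_axioms)
  have f_single: "f (Poly_Mapping.single (a, b) 1) =
      \<beta> (Poly_Mapping.single a 1) (Poly_Mapping.single b 1)" for a b
    by (simp add: f_def)
  have comp_right: "Vector_Spaces.linear scale s (\<lambda>y. f (tensor x y))" for x
    using Vector_Spaces.linear_compose[OF linear_scale_tensor_right f] by (simp add: o_def)
  have comp_left: "Vector_Spaces.linear scale s (\<lambda>x. f (tensor x y))" for y
    using Vector_Spaces.linear_compose[OF linear_scale_tensor_left f] by (simp add: o_def)
  have "(\<lambda>y. f (tensor (Poly_Mapping.single a 1) y)) = \<beta> (Poly_Mapping.single a 1)" for a
    by (rule linear_eq_on_singles[OF comp_right right]) (simp add: tensor_single_single f_single)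
  then have "(\<lambda>x. f (tensor x y)) = (\<lambda>x. \<beta> x y)" for y
    by (intro linear_eq_on_singles[OF comp_left left]) (simp add: fun_eq_iff)
  then have f_tensor: "\<forall>x y. f (tensor x y) = \<beta> x y"
    by (simp add: fun_eq_iff)
  show ?thesis
  proof (rule ex1I[of _ f])
    fix f'
    assume f': "Vector_Spaces.linear scale s f' \<and> (\<forall>x y. f' (tensor x y) = \<beta> x y)"
    have single: "Poly_Mapping.single p 1 =
        tensor (Poly_Mapping.single (fst p) 1) (Poly_Mapping.single (snd p) (1::'k))" for p :: "'a \<times> 'b"
      by (simp add: tensor_single_single)
    show "f' = f"
    proof (rule linear_eq_on_singles[OF _ f])
      fix p
      show "f' (Poly_Mapping.single p 1) = f (Poly_Mapping.single p 1)"
        by (subst (1 2) single) (use f' f_tensor in simp)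
    qed (use f' in blast)
  qed (use f f_tensor in blast)
qed

lemma span_tensor_group_algebra:
  "pm.span {tensor x y | x y. x \<in> group_algebra G \<and> y \<in> group_algebra G} =
    {z :: 'g \<times> 'g \<Rightarrow>\<^sub>0 'k::field. Poly_Mapping.keys z \<subseteq> carrier G \<times> carrier G}"
  (is "pm.span ?T = ?K")
proof
  have "pm.subspace ?K"
    unfolding pm.subspace_def
  proof (intro conjI ballI allI)
    fix x y :: "'g \<times> 'g \<Rightarrow>\<^sub>0 'k"
    assume "x \<in> ?K" "y \<in> ?K"
    then show "x + y \<in> ?K"
      using Poly_Mapping.keys_add[of x y] by (simp add: subset_trans[OF _ Un_least])
  next
    fix c and x :: "'g \<times> 'g \<Rightarrow>\<^sub>0 'k"
    assume "x \<in> ?K"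
    moreover have "Poly_Mapping.keys (scale c x) \<subseteq> Poly_Mapping.keys x"
      by (auto simp: in_keys_iff)
    ultimately show "scale c x \<in> ?K"
      by simp
  qed simp
  moreover have "?T \<subseteq> ?K"
    by (auto simp: group_algebra_def in_keys_iff subset_iff)
  ultimately show "pm.span ?T \<subseteq> ?K"
    by (rule pm.span_minimal[rotated])
next
  show "?K \<subseteq> pm.span ?T"
  proof
    fix z :: "'g \<times> 'g \<Rightarrow>\<^sub>0 'k" assume z: "z \<in> ?K"
    have "Poly_Mapping.single p 1 \<in> ?T" if p: "p \<in> Poly_Mapping.keys z" for p
    proof -
      have "Poly_Mapping.single p 1 =
          tensor (Poly_Mapping.single (fst p) 1) (Poly_Mapping.single (snd p) (1::'k))"
        by (simp add: tensor_single_single)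
      moreover have "fst p \<in> carrier G" "snd p \<in> carrier G"
        using z p by auto
      ultimately show ?thesis
        by (fastforce simp: group_algebra_def)
    qed
    then have "(\<Sum>p\<in>Poly_Mapping.keys z. scale (Poly_Mapping.lookup z p) (Poly_Mapping.single p 1)) \<in> pm.span ?T"
      by (intro pm.span_sum pm.span_scale pm.span_base)
    then show "z \<in> pm.span ?T"
      by (simp only: sum_keys_single)
  qed
qed

lemma linear_Phi: "Vector_Spaces.linear scale scale (Phi G)"
proof -
  have eq: "Phi G = (\<lambda>z. \<Sum>p\<in>Poly_Mapping.keys z. scale (Poly_Mapping.lookup z p)
      (tensor (Poly_Mapping.single (fst p) 1) (Poly_Mapping.single (fst p \<otimes>\<^bsub>G\<^esub> snd p) 1)))"
    by (simp add: Phi_def fun_eq_iff case_prod_unfold)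
  show ?thesis
    unfolding eq by (rule linear_extension) (rule pm.vector_space_axioms)
qed

lemma Phi_tensor_single:
  "Phi G (tensor (Poly_Mapping.single g 1) (Poly_Mapping.single h 1)) =
    tensor (Poly_Mapping.single g 1) (Poly_Mapping.single (g \<otimes>\<^bsub>G\<^esub> h) 1)"
  by (simp add: Phi_def tensor_single_single)

end

theory Submission
  imports Defs
begin

text \<open>
  The tensor \<open>\<Phi>(b \<otimes> b) = (\<Sum>g. b\<^sub>g g \<otimes> gb)\<close> is pure only if the translates \<open>g b\<close>, for
  \<open>g\<close> in the support of \<open>b\<close>, are proportional to each other, so that they have the same support.
  Hence the support of \<open>b\<close>, a finite nonempty set, is stable under left
  multiplication by \<open>h\<^sup>-\<^sup>1 g\<close> for all \<open>g, h\<close> in it, and each such element has finite order.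
  But \<open>(t\<^sup>j x)\<^sup>-\<^sup>1 (t\<^sup>i x)\<close> is conjugate to \<open>t\<^bsup>i - j\<^esup>\<close>.
\<close>

text \<open>The map \<open>(h, y)\<close> to \<open>(h, hy)\<close> is injective on pairs of group
  elements, so \<open>(g, x)\<close> is the only key of \<open>z\<close> that can contribute at
  \<open>(g, gx)\<close>.\<close>

lemma lookup_Phi_mult:
  fixes z :: "'g \<times> 'g \<Rightarrow>\<^sub>0 'k::field"
  assumes "group G" and z: "Poly_Mapping.keys z \<subseteq> carrier G \<times> carrier G"
    and g: "g \<in> carrier G" and x: "x \<in> carrier G"
  shows "Poly_Mapping.lookup (Phi G z) (g, g \<otimes>\<^bsub>G\<^esub> x) = Poly_Mapping.lookup z (g, x)"
proof -
  interpret group G by fact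
  have "Poly_Mapping.lookup (Phi G z) (g, g \<otimes>\<^bsub>G\<^esub> x) =
      (\<Sum>p\<in>Poly_Mapping.keys z. if p = (g, x) then Poly_Mapping.lookup z p else 0)"
    unfolding Phi_def lookup_sum
  proof (rule sum.cong)
    fix p assume "p \<in> Poly_Mapping.keys z"
    with z obtain h y where "p = (h, y)" "h \<in> carrier G" "y \<in> carrier G"
      by blast
    with g x show "Poly_Mapping.lookup (case p of (h, y) \<Rightarrow> scale (Poly_Mapping.lookup z (h, y))
        (tensor (Poly_Mapping.single h 1) (Poly_Mapping.single (h \<otimes>\<^bsub>G\<^esub> y) 1))) (g, g \<otimes>\<^bsub>G\<^esub> x) =
        (if p = (g, x) then Poly_Mapping.lookup z p else 0)"
      by (auto simp: lookup_single when_def)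
  qed simp
  then show ?thesis
    by (simp add: in_keys_iff)
qed

text \<open>Comparing coefficients at \<open>(g, gx)\<close> yields
  \<open>b_g c_x = b'_g c'_(gx)\<close>. Both factors at \<open>g\<close> are nonzero, so
  \<open>c_x\<close> and \<open>c'_(gx)\<close> vanish together. As \<open>c'\<close> does not
  depend on \<open>g\<close>, all translates of the support of \<open>c\<close> by keys of
  \<open>b\<close> coincide.\<close>

lemma keys_translate_if_Phi_pure:
  assumes "group G" and b: "b \<in> group_algebra G" and c: "c \<in> group_algebra G"
    and pure: "Phi G (tensor b c) = tensor b' c'" and "c \<noteq> 0"
    and g: "g \<in> Poly_Mapping.keys b" and x: "x \<in> carrier G"
  shows "g \<otimes>\<^bsub>G\<^esub> x \<in> Poly_Mapping.keys c' \<longleftrightarrow> x \<in> Poly_Mapping.keys c"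
proof -
  have keys: "Poly_Mapping.keys (tensor b c) \<subseteq> carrier G \<times> carrier G"
    using b c by (auto simp: group_algebra_def in_keys_iff subset_iff)
  have gG: "g \<in> carrier G"
    using b g by (auto simp: group_algebra_def)
  have eq: "Poly_Mapping.lookup b g * Poly_Mapping.lookup c y =
      Poly_Mapping.lookup b' g * Poly_Mapping.lookup c' (g \<otimes>\<^bsub>G\<^esub> y)" if "y \<in> carrier G" for y
    using lookup_Phi_mult[OF \<open>group G\<close> keys gG that] by (simp add: pure)
  \<comment> \<open>A key \<open>y\<close> of \<open>c\<close> makes the left side of
    \<open>eq\<close> nonzero, which forces \<open>b'_g\<close> to be nonzero.\<close>
  obtain y where "y \<in> Poly_Mapping.keys c"
    using \<open>c \<noteq> 0\<close> by fastforce
  with c g eq[of y] have "Poly_Mapping.lookup b' g \<noteq> 0"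
    by (auto simp: group_algebra_def in_keys_iff)
  with g eq[OF x] show ?thesis
    by (metis in_keys_iff mult_eq_0_iff)
qed

text \<open>Stability keeps every \<open>a^n x\<close> inside \<open>S\<close>; if \<open>a\<close>
  had infinite order, coded as \<open>ord a = 0\<close>, these elements would be pairwise
  distinct.\<close>

lemma (in group) ord_pos_if_finite_mult_stable:
  assumes S: "finite S" "S \<subseteq> carrier G" "x \<in> S" and a: "a \<in> carrier G"
    and stable: "\<And>y. y \<in> S \<Longrightarrow> a \<otimes> y \<in> S"
  shows "ord a > 0"
proof (rule ccontr)
  assume "\<not> ord a > 0"
  have "a [^] n \<otimes> x \<in> S" for n :: nat
  proof (induction n)
    case (Suc n)
    then show ?case
      using stable[OF Suc] S a by (metis m_assoc nat_pow_Suc2 nat_pow_closed subsetD)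
  qed (use S in auto)
  then have "finite (range (\<lambda>n::nat. a [^] n \<otimes> x))"
    using S by (meson finite_subset image_subsetI)
  moreover have "inj (\<lambda>n::nat. a [^] n \<otimes> x)"
  proof (rule injI)
    fix m n :: nat assume "a [^] m \<otimes> x = a [^] n \<otimes> x"
    then have "a [^] m = a [^] n"
      using S a by (metis nat_pow_closed right_cancel subsetD)
    then show "m = n"
      using int_pow_eq[OF a, of "int m" "int n"] \<open>\<not> ord a > 0\<close> by (simp add: int_pow_int)
  qed
  ultimately show False
    using finite_imageD by blast
qed

text \<open>With \<open>n = ord (a^k)\<close> one has \<open>a^(k n) = 1\<close>, so infinite order
  of \<open>a\<close> forces \<open>k n = 0\<close> and hence \<open>n = 0\<close>.\<close>

lemma (in group) ord_int_pow_eq_0: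
  assumes a: "a \<in> carrier G" and "ord a = 0" and "k \<noteq> (0::int)"
  shows "ord (a [^] k) = 0"
proof -
  have "(a [^] k) [^] ord (a [^] k) = \<one>"
    using a by (intro pow_ord_eq_1) simp
  then have "a [^] (k * int (ord (a [^] k))) = \<one>"
    using a by (metis int_pow_int int_pow_pow)
  then show ?thesis
    using assms by (simp add: int_pow_eq_id)
qed

theorem theorem7p5:
  fixes G :: "('g, 'm) monoid_scheme"
    and t :: 'g
    and B :: "('g \<Rightarrow>\<^sub>0 'k::field) set"
  assumes "group G"
    and "t \<in> carrier G"
    and "group.ord G t = 0"
    and "basis_of_group_algebra G B"
    and "Phi_set_theoretic G B"
  shows "\<forall>b\<in>B. \<forall>g\<in>carrier G.
    card (Poly_Mapping.keys b \<inter> (generate G {t} #>\<^bsub>G\<^esub> g)) \<le> 1"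
proof (intro ballI)
  interpret group G by fact
  fix b x assume "b \<in> B" and x: "x \<in> carrier G"
  have bG: "b \<in> group_algebra G"
    using \<open>b \<in> B\<close> assms(4) pm.span_base unfolding basis_of_group_algebra_def by blast
  then have SG: "Poly_Mapping.keys b \<subseteq> carrier G"
    by (simp add: group_algebra_def)
  obtain b' c' where pure: "Phi G (tensor b b) = tensor b' c'"
    using \<open>b \<in> B\<close> assms(5) unfolding Phi_set_theoretic_def by blast
  have "g = h" if g: "g \<in> Poly_Mapping.keys b \<inter> (generate G {t} #>\<^bsub>G\<^esub> x)"
    and h: "h \<in> Poly_Mapping.keys b \<inter> (generate G {t} #>\<^bsub>G\<^esub> x)" for g h
  proof -
    obtain i j :: int where ij: "g = t [^]\<^bsub>G\<^esub> i \<otimes>\<^bsub>G\<^esub> x" "h = t [^]\<^bsub>G\<^esub> j \<otimes>\<^bsub>G\<^esub> x"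
      using g h generate_pow[OF assms(2)] by (auto simp: r_coset_def)
    have "b \<noteq> 0"
      using g by auto
    note translate = keys_translate_if_Phi_pure[OF \<open>group G\<close> bG bG pure \<open>b \<noteq> 0\<close>]
    \<comment> \<open>Translating the support by \<open>x\<close> undoes the conjugation: stability
      of the support under \<open>h^-1 g = x^-1 t^(i-j) x\<close> becomes stability of
      \<open>x\<close> times the support under \<open>t^(i-j)\<close> itself.\<close>
    have "t [^]\<^bsub>G\<^esub> (i - j) \<otimes>\<^bsub>G\<^esub> z \<in> (\<otimes>\<^bsub>G\<^esub>) x ` Poly_Mapping.keys b"
      if "z \<in> (\<otimes>\<^bsub>G\<^esub>) x ` Poly_Mapping.keys b" for z
    proof -
      obtain y where y: "y \<in> Poly_Mapping.keys b" "z = x \<otimes>\<^bsub>G\<^esub> y"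
        using \<open>z \<in> _\<close> by blast
      have yG: "y \<in> carrier G"
        using y SG by blast
      \<comment> \<open>This is \<open>h^-1 g y\<close> written in terms of \<open>x\<close> and
        \<open>t\<close>.\<close>
      define w where "w = inv\<^bsub>G\<^esub> x \<otimes>\<^bsub>G\<^esub> (t [^]\<^bsub>G\<^esub> (i - j) \<otimes>\<^bsub>G\<^esub> z)"
      have wG: "w \<in> carrier G"
        using x yG assms(2) y by (simp add: w_def)
      have xw: "x \<otimes>\<^bsub>G\<^esub> w = t [^]\<^bsub>G\<^esub> (i - j) \<otimes>\<^bsub>G\<^esub> z"
        using x yG assms(2) y by (simp add: w_def inv_solve_left' flip: m_assoc)
      have "h \<otimes>\<^bsub>G\<^esub> w = t [^]\<^bsub>G\<^esub> j \<otimes>\<^bsub>G\<^esub> (t [^]\<^bsub>G\<^esub> (i - j) \<otimes>\<^bsub>G\<^esub> z)"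
        using x wG assms(2) by (simp add: ij m_assoc xw)
      also have "\<dots> = t [^]\<^bsub>G\<^esub> (j + (i - j)) \<otimes>\<^bsub>G\<^esub> z"
        using x yG y assms(2) by (simp only: int_pow_mult m_assoc int_pow_closed m_closed)
      also have "\<dots> = g \<otimes>\<^bsub>G\<^esub> y"
        using x yG y assms(2) by (simp add: ij m_assoc)
      finally have "h \<otimes>\<^bsub>G\<^esub> w = g \<otimes>\<^bsub>G\<^esub> y" .
      \<comment> \<open>The support of \<open>c'\<close> is the link: \<open>y\<close> in the
        support of \<open>b\<close> puts \<open>gy = hw\<close> into it, and reading the equivalence
        backwards at \<open>h\<close> returns \<open>w\<close> to the support of
        \<open>b\<close>.\<close>
      then have "w \<in> Poly_Mapping.keys b"
        using translate[of g y] translate[of h w] g h y yG wG by simp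
      then show ?thesis
        using xw by (metis imageI)
    qed
    then have "ord (t [^]\<^bsub>G\<^esub> (i - j)) > 0"
      using SG x g assms(2)
      by (intro ord_pos_if_finite_mult_stable[of "(\<otimes>\<^bsub>G\<^esub>) x ` Poly_Mapping.keys b" "x \<otimes>\<^bsub>G\<^esub> g"]) auto
    then have "i = j"
      using ord_int_pow_eq_0[OF assms(2,3), of "i - j"] by auto
    then show "g = h"
      by (simp add: ij)
  qed
  then show "card (Poly_Mapping.keys b \<inter> (generate G {t} #>\<^bsub>G\<^esub> x)) \<le> 1"
    by (simp add: card_le_Suc0_iff_eq)
qed

end
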